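(* Let $K$ be an imaginary quadratic number field, and let $Y\subseteq\mathbb{C}\cong K_S$ be the support of an Ahlfors regular measure. Then $\mathbf{BA}_K$ is absolute winning on $Y$.
   Context: Here $K$ is regarded as embedded in $\mathbb{C}$ (via its single Archimedean place, up to conjugation), $K_S=\mathbb{C}$ with the usual absolute value, and $\mathcal{O}$ is the ring of integers of $K$. An element $x\in\mathbb{C}$ is badly approximable (with respect to $K$) if there is $c>0$ such that $|qx+p|>c\,|q|^{-1}$ for all $p\in\mathcal{O}$, $q\in\mathcal{O}\smallsetminus\{0\}$; $\mathbf{BA}_K$ is the set of all such $x$. A measure $\mu$ with support $Y$ is Ahlfors regular if there exist constants $a,b,\delta,r_0>0$ such that $ar^\delta\le\mu(\mathbf{B}(z,r))\le br^\delta$ for all $z\in Y$ and all $0<r\le r_0$, where $\mathbf{B}(z,r)$ is the closed ball of radius $r$ centered at $z$. The $\mathcal{H}$-absolute game. Let $(X,\mathrm{dist})$ be a complete metric space, $\mathcal{H}$ a non-empty collection of closed subsets of $X$, $Y\subseteq X$ non-empty closed, $0<\beta<1$. A formal ball is a pair $B=(x,\rho)\in X\times\mathbb{R}_{>0}$, with associated closed ball $\mathbf{B}(B)=\{y\in X:\mathrm{dist}(x,y)\le\rho\}$; write $(x_1,\rho_1)\preceq(x_2,\rho_2)$ iff $\mathrm{dist}(x_1,x_2)\le\rho_2-\rho_1$. In the $(\mathcal{H},\beta)$-absolute game on $Y$, Bob and Alice alternately choose $B_1,A_1,B_2,A_2,\dots$ such that: Bob chooses $B_n=(c_n,r_n)\in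 Y\times\mathbb{R}_{>0}$; Alice chooses $A_n=(\mathcal{L}_n,\rho_n)\in\mathcal{H}\times\mathbb{R}_{>0}$ with $0<\rho_n\le\beta r_n$; $\beta r_n\le r_{n+1}\le r_n$ and $B_{n+1}\preceq B_n$; and $\mathrm{dist}(c_{n+1},\mathcal{L}_n)>\rho_n+r_{n+1}$. If at some stage Bob has no legal choice of $B_{n+1}$, the game ends and Bob wins. $W\subseteq X$ is $(\mathcal{H},\beta)$-absolute winning on $Y$ if Alice has a strategy ensuring that Bob always has a legal move and that $W\cap Y\cap\bigcap_{n\ge1}\mathbf{B}(B_n)\ne\varnothing$ regardless of Bob's play. $W$ is $\mathcal{H}$-absolute winning on $Y$ if there is $\beta_0>0$ such that $W$ is $(\mathcal{H},\beta)$-absolute winning on $Y$ for all $0<\beta<\beta_0$. "Absolute winning on $Y$" means $\mathcal{H}$-absolute winning on $Y$ for $\mathcal{H}=\{\{x\}:x\in X\}$, the collection of all singletons. Here $X=\mathbb{C}$. *)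

theory Defs
  imports "HOL-Analysis.Analysis" "HOL-Computational_Algebra.Polynomial"
begin

section \<open>Imaginary quadratic fields and badly approximable numbers\<close>

text \<open>
  A number field with a single, Archimedean complex place is given here as its image under one of
  the two conjugate embeddings, i.e. as a subfield of the complex numbers. Quadratic means
  dimension 2 over the rationals; imaginary means not contained in the reals.
\<close>

definition imaginary_quadratic_field :: "complex set \<Rightarrow> bool" where
  "imaginary_quadratic_field K \<longleftrightarrow>
     0 \<in> K \<and> 1 \<in> K \<and>
     (\<forall>x\<in>K. \<forall>y\<in>K. x + y \<in> K \<and> x * y \<in> K) \<and>
     (\<forall>x\<in>K. - x \<in> K \<and> inverse x \<in> K) \<and>
     vector_space.dim (\<lambda>(r::rat) (z::complex). of_rat r * z) K = 2 \<and>
     \<not> K \<subseteq> \<real>"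

text \<open>The locale constant above is only meaningful because of the following instance.\<close>

lemma vector_space_rat_complex: "vector_space (\<lambda>(r::rat) (z::complex). of_rat r * z)"
  by unfold_locales (simp_all add: algebra_simps of_rat_add of_rat_mult)

definition ring_of_integers :: "complex set \<Rightarrow> complex set" where
  "ring_of_integers K = {x \<in> K. algebraic_int x}"

definition BA :: "complex set \<Rightarrow> complex set" where
  "BA K = {x. \<exists>c::real. c > 0 \<and>
     (\<forall>p \<in> ring_of_integers K. \<forall>q \<in> ring_of_integers K - {0}.
        norm (q * x + p) > c * inverse (norm q))}"

section \<open>Ahlfors regular measures\<close>

definition measure_support :: "'a::topological_space measure \<Rightarrow> 'a set" where
  "measure_support M = {z. \<forall>U. open U \<and> z \<in> U \<longrightarrow> emeasure M U > 0}"

definition Ahlfors_regular :: "'a::metric_space measure \<Rightarrow> bool" where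
  "Ahlfors_regular M \<longleftrightarrow>
     (\<exists>a b d r0 :: real. a > 0 \<and> b > 0 \<and> d > 0 \<and> r0 > 0 \<and>
       (\<forall>z \<in> measure_support M. \<forall>r. 0 < r \<and> r \<le> r0 \<longrightarrow>
          ennreal (a * r powr d) \<le> emeasure M (cball z r) \<and>
          emeasure M (cball z r) \<le> ennreal (b * r powr d)))"

section \<open>The absolute game\<close>

text \<open>The ambient space is the whole type. A formal ball is a pair of a centre and a radius;
  positivity of the radius is part of the rules of the game.\<close>

type_synonym 'a formal_ball = "'a \<times> real"

definition ball_of :: "'a::metric_space formal_ball \<Rightarrow> 'a set" where
  "ball_of B = cball (fst B) (snd B)"

definition formal_le :: "'a::metric_space formal_ball \<Rightarrow> 'a formal_ball \<Rightarrow> bool" where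
  "formal_le B1 B2 \<longleftrightarrow> dist (fst B1) (fst B2) \<le> snd B2 - snd B1"

text \<open>The relation \<open>dist(c, L) > s\<close>, with the usual convention that the distance to the empty set is
  infinite (whereas \<^term>\<open>infdist c {} = 0\<close>).\<close>

definition dist_set_greater :: "'a::metric_space \<Rightarrow> 'a set \<Rightarrow> real \<Rightarrow> bool" where
  "dist_set_greater c L s \<longleftrightarrow> L = {} \<or> infdist c L > s"

definition legal_first :: "'a::metric_space set \<Rightarrow> 'a formal_ball \<Rightarrow> bool" where
  "legal_first Y B \<longleftrightarrow> fst B \<in> Y \<and> snd B > 0"

definition legal_Alice ::
  "'a::metric_space set set \<Rightarrow> real \<Rightarrow> 'a formal_ball \<Rightarrow> 'a set \<times> real \<Rightarrow> bool" where
  "legal_Alice H \<beta> B A \<longleftrightarrow> fst A \<in> H \<and> 0 < snd A \<and> snd A \<le> \<beta> * snd B"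

definition legal_Bob ::
  "'a::metric_space set \<Rightarrow> real \<Rightarrow> 'a formal_ball \<Rightarrow> 'a set \<times> real \<Rightarrow> 'a formal_ball \<Rightarrow> bool" where
  "legal_Bob Y \<beta> B A B' \<longleftrightarrow>
     fst B' \<in> Y \<and> snd B' > 0 \<and>
     \<beta> * snd B \<le> snd B' \<and> snd B' \<le> snd B \<and> formal_le B' B \<and>
     dist_set_greater (fst B') (fst A) (snd A + snd B')"

text \<open>A strategy for Alice maps the non-empty list of Bob's moves so far, oldest first, to her reply;
  her own earlier moves are determined by it. Bob's moves are indexed from 0.\<close>

type_synonym 'a strategy = "'a formal_ball list \<Rightarrow> 'a set \<times> real"

definition reply :: "'a strategy \<Rightarrow> (nat \<Rightarrow> 'a formal_ball) \<Rightarrow> nat \<Rightarrow> 'a set \<times> real" where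
  "reply \<sigma> B n = \<sigma> (map B [0..<Suc n])"

definition legal_upto ::
  "'a::metric_space set \<Rightarrow> real \<Rightarrow> 'a strategy \<Rightarrow> (nat \<Rightarrow> 'a formal_ball) \<Rightarrow> nat \<Rightarrow> bool" where
  "legal_upto Y \<beta> \<sigma> B n \<longleftrightarrow>
     legal_first Y (B 0) \<and> (\<forall>k<n. legal_Bob Y \<beta> (B k) (reply \<sigma> B k) (B (Suc k)))"

definition game_winning ::
  "'a::metric_space set set \<Rightarrow> real \<Rightarrow> 'a set \<Rightarrow> 'a set \<Rightarrow> bool" where
  "game_winning H \<beta> W Y \<longleftrightarrow>
     (\<exists>\<sigma>. \<forall>B.
        (\<forall>n. legal_upto Y \<beta> \<sigma> B n \<longrightarrow>
             legal_Alice H \<beta> (B n) (reply \<sigma> B n) \<and>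
             (\<exists>B'. legal_Bob Y \<beta> (B n) (reply \<sigma> B n) B')) \<and>
        ((\<forall>n. legal_upto Y \<beta> \<sigma> B n) \<longrightarrow> W \<inter> Y \<inter> (\<Inter>n. ball_of (B n)) \<noteq> {}))"

text \<open>The game is only considered for \<open>0 < \<beta> < 1\<close>, hence \<open>\<beta>0 \<le> 1\<close>.\<close>

definition H_absolute_winning :: "'a::metric_space set set \<Rightarrow> 'a set \<Rightarrow> 'a set \<Rightarrow> bool" where
  "H_absolute_winning H W Y \<longleftrightarrow>
     (\<exists>\<beta>0. 0 < \<beta>0 \<and> \<beta>0 \<le> 1 \<and> (\<forall>\<beta>. 0 < \<beta> \<and> \<beta> < \<beta>0 \<longrightarrow> game_winning H \<beta> W Y))"

definition absolute_winning :: "'a::metric_space set \<Rightarrow> 'a set \<Rightarrow> bool" where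
  "absolute_winning W Y \<longleftrightarrow> H_absolute_winning (range (\<lambda>x. {x})) W Y"

end

theory Submission
  imports Defs
begin

text \<open>
  Two distinct fractions with denominators \<open>q\<close>, \<open>q'\<close> are at distance at least \<open>1 / |q q'|\<close>, because
  nonzero integers of \<open>K\<close> have absolute value at least 1. Hence Bob's ball of radius \<open>r\<close> has at most
  one fraction with \<open>4 r |q|\<^sup>2 < 1\<close> near it, and Alice deletes it. If the ball is the first
  one with \<open>4 r |q|\<^sup>2 < 1\<close>, then \<open>r\<close> is comparable to \<open>1 / |q|\<^sup>2\<close>, so the final point stays at
  distance at least a constant times \<open>1 / |q|\<^sup>2\<close> from every fraction. Ahlfors regularity provides Bob
  with legal moves once his balls are small; while they are large, Alice deletes a far away point.
\<close>

section \<open>Integers of an imaginary quadratic field\<close>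

definition int_lattice :: "complex \<Rightarrow> complex \<Rightarrow> complex set" where
  "int_lattice u v = {of_int a * u + of_int b * v | a b :: int. True}"

lemma int_lattice_diff:
  assumes "x \<in> int_lattice u v" "y \<in> int_lattice u v"
  shows "x - y \<in> int_lattice u v"
proof -
  obtain a b c d :: int where "x = of_int a * u + of_int b * v" "y = of_int c * u + of_int d * v"
    using assms unfolding int_lattice_def by blast
  then have "x - y = of_int (a - c) * u + of_int (b - d) * v"
    by (simp add: algebra_simps)
  then show ?thesis
    unfolding int_lattice_def by blast
qed

lemma int_lattice_scale:
  assumes "x \<in> int_lattice u v"
  shows "of_int k * x \<in> int_lattice u v"
proof -
  obtain a b :: int where "x = of_int a * u + of_int b * v"
    using assms unfolding int_lattice_def by blast
  then have "of_int k * x = of_int (k * a) * u + of_int (k * b) * v"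
    by (simp add: algebra_simps)
  then show ?thesis
    unfolding int_lattice_def by blast
qed

lemma int_lattice_generators: "u \<in> int_lattice u v" "v \<in> int_lattice u v"
proof -
  have "u = of_int 1 * u + of_int 0 * v" "v = of_int 0 * u + of_int 1 * v"
    by simp_all
  then show "u \<in> int_lattice u v" "v \<in> int_lattice u v"
    unfolding int_lattice_def by blast+
qed

text \<open>Pairing \<open>z = a u + b v\<close> with \<open>cnj v\<close> kills the
  \<open>v\<close> term in the imaginary part and leaves \<open>a\<close> times
  \<open>Im (u * cnj v)\<close>, the covolume up to sign; pairing with \<open>cnj u\<close> leaves
  \<open>- b\<close> times it. One of the two integers is nonzero.\<close>

lemma int_lattice_discrete:
  assumes "Im (u * cnj v) \<noteq> 0" "z \<in> int_lattice u v" "z \<noteq> 0"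
  shows "\<bar>Im (u * cnj v)\<bar> \<le> norm z * (norm u + norm v)"
proof -
  obtain a b :: int where z: "z = of_int a * u + of_int b * v"
    using assms(2) unfolding int_lattice_def by blast
  let ?w = "Im (u * cnj v)"
  have za: "Im (z * cnj v) = of_int a * ?w" and zb: "Im (z * cnj u) = - (of_int b * ?w)"
    unfolding z by (simp_all add: algebra_simps)
  have "a \<noteq> 0 \<or> b \<noteq> 0"
    using assms(3) z by auto
  then have "\<bar>?w\<bar> \<le> \<bar>Im (z * cnj v)\<bar> \<or> \<bar>?w\<bar> \<le> \<bar>Im (z * cnj u)\<bar>"
  proof (elim disjE)
    assume "a \<noteq> 0"
    then have "1 \<le> \<bar>real_of_int a\<bar>" by linarith
    then have "1 * \<bar>?w\<bar> \<le> \<bar>real_of_int a\<bar> * \<bar>?w\<bar>" by (intro mult_right_mono) auto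
    then show ?thesis by (intro disjI1) (simp only: za abs_mult mult_1)
  next
    assume "b \<noteq> 0"
    then have "1 \<le> \<bar>real_of_int b\<bar>" by linarith
    then have "1 * \<bar>?w\<bar> \<le> \<bar>real_of_int b\<bar> * \<bar>?w\<bar>" by (intro mult_right_mono) auto
    then show ?thesis by (intro disjI2) (simp only: zb abs_minus_cancel abs_mult mult_1)
  qed
  moreover have "\<bar>Im (z * cnj v)\<bar> \<le> norm z * norm v" "\<bar>Im (z * cnj u)\<bar> \<le> norm z * norm u"
    by (metis abs_Im_le_cmod norm_mult complex_mod_cnj)+
  moreover have "0 \<le> norm z * norm v" "0 \<le> norm z * norm u" by auto
  ultimately show ?thesis
    unfolding distrib_left by linarith
qed

text \<open>The common denominator \<open>N\<close> takes the place of finite generation: it puts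
  the subgroup \<open>M\<close> inside a scaled lattice, which is discrete once
  \<open>Im (u * cnj v)\<close> is nonzero. Membership of \<open>u\<close> supplies a fixed vector
  for the multipliers of \<open>M\<close> to act on.\<close>

definition fractional_module :: "complex \<Rightarrow> complex \<Rightarrow> complex set \<Rightarrow> bool" where
  "fractional_module u v M \<longleftrightarrow> u \<in> M \<and> (\<forall>x\<in>M. \<forall>y\<in>M. x - y \<in> M) \<and>
     (\<exists>N::int. N > 0 \<and> (\<forall>x\<in>M. of_int N * x \<in> int_lattice u v))"

lemma diff_closed_of_int_mult:
  fixes x :: "'a::comm_ring_1"
  assumes diff: "\<forall>x\<in>M. \<forall>y\<in>M. x - y \<in> M" and x: "x \<in> M"
  shows "of_int k * x \<in> M"
proof (induction k rule: int_induct[where k = 0])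
  case base
  show ?case using diff x by (metis diff_self mult_zero_left of_int_0)
next
  case (step1 i)
  have "0 \<in> M" using diff x by (metis diff_self)
  then have "0 - x \<in> M" using diff x by blast
  then have "of_int i * x - (0 - x) \<in> M" using diff step1 by blast
  then show ?case by (simp add: algebra_simps)
next
  case (step2 i)
  then have "of_int i * x - x \<in> M" using diff x by blast
  then show ?case by (simp add: algebra_simps)
qed

text \<open>\<open>non_real\<close> is independence of \<open>u\<close> and \<open>v\<close> over
  the reals. Independence over the rationals alone would not make \<open>int_lattice u v\<close>
  discrete.\<close>

locale quadratic_basis =
  fixes K :: "complex set" and u v :: complex
  assumes mult_closed: "x \<in> K \<Longrightarrow> y \<in> K \<Longrightarrow> x * y \<in> K"
    and one_mem: "1 \<in> K"
    and basis_mem: "u \<in> K" "v \<in> K"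
    and basis_span: "x \<in> K \<Longrightarrow> \<exists>r s::rat. x = of_rat r * u + of_rat s * v"
    and non_real: "Im (u * cnj v) \<noteq> 0"
begin

lemma power_mem: "x \<in> K \<Longrightarrow> x ^ n \<in> K"
  by (induction n) (auto intro: one_mem mult_closed)

lemma clear_denominator:
  assumes "x \<in> K"
  shows "\<exists>N::int. N > 0 \<and> of_int N * x \<in> int_lattice u v"
proof -
  obtain r s :: rat where x: "x = of_rat r * u + of_rat s * v"
    using basis_span[OF assms] by blast
  obtain a b where r: "r = of_int a / of_int b" "b > 0"
    by (metis quotient_of_div quotient_of_denom_pos surj_pair)
  obtain c d where s: "s = of_int c / of_int d" "d > 0"
    by (metis quotient_of_div quotient_of_denom_pos surj_pair)
  have "of_rat r = (of_int a / of_int b :: complex)" "of_rat s = (of_int c / of_int d :: complex)"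
    by (simp_all add: r s of_rat_divide)
  then have "of_int (b * d) * x = of_int (a * d) * u + of_int (b * c) * v"
    using r(2) s(2) unfolding x by (simp add: field_simps)
  then have "of_int (b * d) * x \<in> int_lattice u v"
    unfolding int_lattice_def by blast
  then show ?thesis
    using r(2) s(2) by (intro exI[of _ "b * d"]) simp
qed

lemma clear_denominator_mult:
  assumes "x \<in> K"
  shows "\<exists>N::int. N > 0 \<and> (\<forall>y\<in>int_lattice u v. of_int N * (x * y) \<in> int_lattice u v)"
proof -
  obtain N1 :: int where N1: "N1 > 0" "of_int N1 * (x * u) \<in> int_lattice u v"
    using clear_denominator mult_closed assms basis_mem by blast
  obtain N2 :: int where N2: "N2 > 0" "of_int N2 * (x * v) \<in> int_lattice u v"
    using clear_denominator mult_closed assms basis_mem by blast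
  have "of_int (N1 * N2) * (x * y) \<in> int_lattice u v" if yL: "y \<in> int_lattice u v" for y
  proof -
    obtain a b :: int where y: "y = of_int a * u + of_int b * v"
      using yL unfolding int_lattice_def by blast
    have "of_int (N1 * N2) * (x * y) =
        of_int (N2 * a) * (of_int N1 * (x * u)) - of_int (- N1 * b) * (of_int N2 * (x * v))"
      unfolding y by (simp add: algebra_simps)
    then show ?thesis
      by (metis int_lattice_diff int_lattice_scale N1(2) N2(2))
  qed
  then show ?thesis
    using N1(1) N2(1) by (intro exI[of _ "N1 * N2"]) simp
qed

text \<open>Take \<open>M'\<close> to be M + x M + ... + x^e M. A monic equation of degree e + 1
  rewrites x^(e+1) through lower powers with integer coefficients, so \<open>M'\<close> absorbs
  \<open>x\<close>. The last clause preserves earlier multipliers, which lets integers be adjoined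
  one after another.\<close>

lemma fractional_module_adjoin:
  assumes M: "fractional_module u v M" and xK: "x \<in> K" and x: "algebraic_int x"
  shows "\<exists>M'. fractional_module u v M' \<and> (\<forall>y\<in>M'. x * y \<in> M') \<and>
     (\<forall>t. (\<forall>y\<in>M. t * y \<in> M) \<longrightarrow> (\<forall>y\<in>M'. t * y \<in> M'))"
proof -
  have diff: "\<forall>x\<in>M. \<forall>y\<in>M. x - y \<in> M" and uM: "u \<in> M"
    using M unfolding fractional_module_def by auto
  obtain N :: int where N: "N > 0" "\<And>y. y \<in> M \<Longrightarrow> of_int N * y \<in> int_lattice u v"
    using M unfolding fractional_module_def by auto
  have zero: "0 \<in> M" using diff uM by (metis diff_self)
  obtain p where p: "poly (map_poly of_int p) x = 0" "lead_coeff p = 1"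
    using x unfolding algebraic_int_altdef_ipoly by blast
  \<comment> \<open>A monic constant is 1 and has no root. Positive degree puts the index 0 into the
    sums below, which is how \<open>u\<close> gets into \<open>M'\<close>.\<close>
  have "degree p \<noteq> 0"
  proof
    assume "degree p = 0"
    then obtain c where "p = [:c:]" by (rule degree_eq_zeroE)
    then show False using p by (auto simp: map_poly_pCons)
  qed
  then obtain e where e: "degree p = Suc e" by (cases "degree p") auto
  define c where "c i = coeff p i" for i
  have "0 = (\<Sum>i\<le>Suc e. of_int (c i) * x ^ i)"
    using p(1) by (simp add: poly_altdef degree_map_poly coeff_map_poly e c_def)
  then have xe: "x ^ Suc e = - (\<Sum>i<Suc e. of_int (c i) * x ^ i)"
    using p(2) by (simp add: e c_def lessThan_Suc_atMost eq_neg_iff_add_eq_0 add.commute)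
  define M' where "M' = {\<Sum>i<Suc e. x ^ i * m i | m. \<forall>i. m i \<in> M}"
  have M'I: "(\<Sum>i<Suc e. x ^ i * m i) \<in> M'" if "\<And>i. m i \<in> M" for m
    using that unfolding M'_def by blast
  have "x * y \<in> M'" if yM: "y \<in> M'" for y
  proof -
    obtain m where y: "y = (\<Sum>i<Suc e. x ^ i * m i)" and m: "\<And>i. m i \<in> M"
      using yM unfolding M'_def by blast
    \<comment> \<open>Coefficients of \<open>x * y\<close>: those of \<open>y\<close> shifted up by
      one, with the top term \<open>x ^ Suc e * m e\<close> redistributed by the monic
      equation.\<close>
    define m' where "m' i = (if i = 0 then 0 else m (i - 1)) - of_int (c i) * m e" for i
    have "x * y = (\<Sum>i<e. x ^ Suc i * m i) + x ^ Suc e * m e"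
      unfolding y by (simp add: sum_distrib_left algebra_simps)
    also have "(\<Sum>i<e. x ^ Suc i * m i) = (\<Sum>i<Suc e. x ^ i * (if i = 0 then 0 else m (i - 1)))"
      by (subst sum.lessThan_Suc_shift) simp
    also have "x ^ Suc e * m e = - (\<Sum>i<Suc e. x ^ i * (of_int (c i) * m e))"
      unfolding xe minus_mult_left[symmetric] sum_distrib_right by (simp only: mult_ac)
    finally have "x * y = (\<Sum>i<Suc e. x ^ i * m' i)"
      unfolding m'_def right_diff_distrib sum_subtractf by simp
    moreover have "m' i \<in> M" for i
      unfolding m'_def using diff zero m diff_closed_of_int_mult[OF diff m] by simp
    ultimately show ?thesis using M'I by metis
  qed
  moreover have "t * y \<in> M'" if t: "\<forall>y\<in>M. t * y \<in> M" and yM: "y \<in> M'" for t y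
  proof -
    obtain m where y: "y = (\<Sum>i<Suc e. x ^ i * m i)" and m: "\<And>i. m i \<in> M"
      using yM unfolding M'_def by blast
    have "t * y = (\<Sum>i<Suc e. x ^ i * (t * m i))"
      unfolding y sum_distrib_left by (simp only: mult_ac)
    then show ?thesis using M'I[of "\<lambda>i. t * m i"] m t by simp
  qed
  moreover have "fractional_module u v M'"
    unfolding fractional_module_def
  proof (intro conjI ballI)
    have "u = (\<Sum>i<Suc e. x ^ i * (if i = 0 then u else 0))"
      by (subst sum.lessThan_Suc_shift) simp
    then show "u \<in> M'"
      using M'I[of "\<lambda>i. if i = 0 then u else 0"] uM zero by simp
  next
    fix y z assume "y \<in> M'" "z \<in> M'"
    then obtain m n where y: "y = (\<Sum>i<Suc e. x ^ i * m i)" and m: "\<And>i. m i \<in> M"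
      and z: "z = (\<Sum>i<Suc e. x ^ i * n i)" and n: "\<And>i. n i \<in> M"
      unfolding M'_def by blast
    have "y - z = (\<Sum>i<Suc e. x ^ i * (m i - n i))"
      unfolding y z right_diff_distrib sum_subtractf ..
    then show "y - z \<in> M'" using M'I[of "\<lambda>i. m i - n i"] m n diff by simp
  next
    \<comment> \<open>Induction on the number of summands, with \<open>D\<close> uniform in the
      coefficients: \<open>N\<close> moves \<open>m k\<close> into the lattice, and \<open>P\<close>
      clears the denominators of multiplication by \<open>x ^ k\<close>.\<close>
    have "\<exists>D::int. D > 0 \<and> (\<forall>m. (\<forall>i. m i \<in> M) \<longrightarrow>
        of_int D * (\<Sum>i<k. x ^ i * m i) \<in> int_lattice u v)" for k
    proof (induction k)
      case 0
      have "0 \<in> int_lattice u v"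
        using int_lattice_diff int_lattice_generators(1) by (metis diff_self)
      then show ?case by (intro exI[of _ 1]) simp
    next
      case (Suc k)
      then obtain D :: int where D: "D > 0"
        "\<And>m. (\<And>i. m i \<in> M) \<Longrightarrow> of_int D * (\<Sum>i<k. x ^ i * m i) \<in> int_lattice u v"
        by blast
      obtain P :: int where P: "P > 0"
        "\<And>y. y \<in> int_lattice u v \<Longrightarrow> of_int P * (x ^ k * y) \<in> int_lattice u v"
        using clear_denominator_mult[OF power_mem[OF xK]] by blast
      have "of_int (D * (P * N)) * (\<Sum>i<Suc k. x ^ i * m i) \<in> int_lattice u v"
        if m: "\<And>i. m i \<in> M" for m
      proof -
        have "of_int (D * (P * N)) * (\<Sum>i<Suc k. x ^ i * m i) =
          of_int (P * N) * (of_int D * (\<Sum>i<k. x ^ i * m i)) -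
          of_int (- D) * (of_int P * (x ^ k * (of_int N * m k)))"
          by (simp add: algebra_simps)
        also have "\<dots> \<in> int_lattice u v"
          by (intro int_lattice_diff int_lattice_scale D(2) P(2) N(2) m)
        finally show ?thesis .
      qed
      then show ?case
        using D(1) P(1) N(1) by (intro exI[of _ "D * (P * N)"]) auto
    qed
    from this[of "Suc e"] show "\<exists>D::int. D > 0 \<and> (\<forall>y\<in>M'. of_int D * y \<in> int_lattice u v)"
      unfolding M'_def by blast
  qed
  ultimately show ?thesis by (intro exI[of _ M']) blast
qed

lemma fractional_module_adjoin_set:
  assumes "finite X" "X \<subseteq> ring_of_integers K"
  shows "\<exists>M. fractional_module u v M \<and> (\<forall>x\<in>X. \<forall>y\<in>M. x * y \<in> M)"
  using assms
proof (induction X)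
  case empty
  have "fractional_module u v (int_lattice u v)"
    unfolding fractional_module_def
    by (intro conjI ballI int_lattice_generators int_lattice_diff exI[of _ 1]) auto
  then show ?case by blast
next
  case (insert x X)
  then obtain M where M: "fractional_module u v M" "\<forall>x\<in>X. \<forall>y\<in>M. x * y \<in> M"
    by blast
  obtain M' where "fractional_module u v M'" "\<forall>y\<in>M'. x * y \<in> M'"
    "\<forall>t. (\<forall>y\<in>M. t * y \<in> M) \<longrightarrow> (\<forall>y\<in>M'. t * y \<in> M')"
    using fractional_module_adjoin[OF M(1), of x] insert.prems
    unfolding ring_of_integers_def by blast
  with M(2) show ?case by (intro exI[of _ M']) blast
qed

text \<open>
  All powers of the determinant lie in one discrete group, so they cannot tend to 0. This avoids
  showing that the algebraic integers form a ring.
\<close>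

lemma norm_det_ge_1:
  assumes O: "p \<in> ring_of_integers K" "q \<in> ring_of_integers K"
      "p' \<in> ring_of_integers K" "q' \<in> ring_of_integers K"
    and nz: "p * q' - p' * q \<noteq> 0"
  shows "norm (p * q' - p' * q) \<ge> 1"
proof (rule ccontr)
  let ?D = "p * q' - p' * q"
  assume "\<not> norm ?D \<ge> 1"
  then have lt: "norm ?D < 1" by simp
  obtain M where M: "fractional_module u v M" and X: "\<forall>x\<in>{p, q, p', q'}. \<forall>y\<in>M. x * y \<in> M"
    using fractional_module_adjoin_set[of "{p, q, p', q'}"] O by auto
  obtain N :: int where N: "N > 0" "\<And>y. y \<in> M \<Longrightarrow> of_int N * y \<in> int_lattice u v"
    using M unfolding fractional_module_def by auto
  have "?D * y \<in> M" if "y \<in> M" for y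
  proof -
    have "p * (q' * y) \<in> M" "p' * (q * y) \<in> M" using X that by auto
    then have "p * (q' * y) - p' * (q * y) \<in> M" using M unfolding fractional_module_def by blast
    then show ?thesis by (simp add: algebra_simps)
  qed
  then have Dn: "?D ^ n * u \<in> M" for n
    using M by (induction n) (auto simp: fractional_module_def mult.assoc)
  have u: "u \<noteq> 0" using non_real by auto
  \<comment> \<open>\<open>int_lattice_discrete\<close> will be applied to \<open>N\<close> times
    \<open>?D ^ n * u\<close>; \<open>?C\<close> collects the factors of that bound which do not
    depend on \<open>n\<close>.\<close>
  let ?C = "(norm u + norm v) * (of_int N * norm u)"
  have low: "\<bar>Im (u * cnj v)\<bar> \<le> norm ?D ^ n * ?C" for n
  proof -
    have "of_int N * (?D ^ n * u) \<noteq> 0" using nz N(1) u by simp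
    from int_lattice_discrete[OF non_real N(2)[OF Dn] this]
    show ?thesis using N(1) by (simp add: norm_mult norm_power mult_ac)
  qed
  have "(\<lambda>n. norm ?D ^ n * ?C) \<longlonglongrightarrow> 0 * ?C"
    using lt by (intro tendsto_mult LIMSEQ_power_zero tendsto_const) auto
  then have "\<bar>Im (u * cnj v)\<bar> \<le> 0 * ?C"
    by (rule Lim_bounded2[where N = 0]) (use low in auto)
  then show False using non_real by simp
qed

end

text \<open>If a rational basis were dependent over the reals, all of \<open>K\<close> would lie on
  the real line through \<open>v\<close>. As 1 is in \<open>K\<close>, this line is the real axis,
  contradicting that \<open>K\<close> is not real.\<close>

lemma imaginary_quadratic_field_basis:
  assumes "imaginary_quadratic_field K"
  shows "\<exists>u v. quadratic_basis K u v"
proof -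
  interpret V: vector_space "\<lambda>(r::rat) (z::complex). of_rat r * z"
    by (rule vector_space_rat_complex)
  have K: "1 \<in> K" "\<And>x y. x \<in> K \<Longrightarrow> y \<in> K \<Longrightarrow> x * y \<in> K" "\<not> K \<subseteq> \<real>"
    and dim: "V.dim K = 2"
    using assms unfolding imaginary_quadratic_field_def by auto
  obtain B where B: "B \<subseteq> K" "V.independent B" "K \<subseteq> V.span B" "card B = 2"
    using V.basis_exists dim by metis
  then obtain u v where uv: "B = {u, v}" "u \<noteq> v" by (auto simp: card_2_iff)
  have span: "\<exists>r s::rat. x = of_rat r * u + of_rat s * v" if "x \<in> K" for x
  proof -
    have "x \<in> V.span {u, v}" using that B uv by auto
    then obtain r s where "x - of_rat r * u = of_rat s * v"
      by (auto simp: V.span_insert V.span_singleton)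
    then have "x = of_rat r * u + of_rat s * v" by (simp add: algebra_simps)
    then show ?thesis by blast
  qed
  have v0: "v \<noteq> 0" using B(2) uv V.dependent_zero by blast
  have "Im (u * cnj v) \<noteq> 0"
  proof
    assume w: "Im (u * cnj v) = 0"
    have im: "Im (x * cnj v) = 0" if xK: "x \<in> K" for x
    proof -
      obtain r s :: rat where x: "x = of_rat r * u + of_rat s * v" using span xK by blast
      have re: "of_rat t = complex_of_real (of_rat t)" for t :: rat
        by (cases t) (simp add: of_rat_rat)
      have "Im (x * cnj v) = of_rat r * Im (u * cnj v) + of_rat s * Im (v * cnj v)"
        unfolding x re by (simp add: algebra_simps)
      then show ?thesis using w by simp
    qed
    have "Im v = 0" using im[OF K(1)] by simp
    then have "Re v \<noteq> 0" using v0 by (simp add: complex_eq_iff)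
    then have "Im x = 0" if "x \<in> K" for x
      using im[OF that] \<open>Im v = 0\<close> by simp
    then show False using K(3) by (auto simp: complex_is_Real_iff)
  qed
  then have "quadratic_basis K u v"
    using K B uv span by unfold_locales auto
  then show ?thesis by blast
qed

lemma ring_of_integers_det:
  assumes "imaginary_quadratic_field K"
    and "p \<in> ring_of_integers K" "q \<in> ring_of_integers K"
      "p' \<in> ring_of_integers K" "q' \<in> ring_of_integers K"
    and "p * q' - p' * q \<noteq> 0"
  shows "norm (p * q' - p' * q) \<ge> 1"
  using imaginary_quadratic_field_basis[OF assms(1)] quadratic_basis.norm_det_ge_1 assms(2-) by blast

lemma ring_of_integers_norm_ge_1:
  assumes "imaginary_quadratic_field K" "q \<in> ring_of_integers K" "q \<noteq> 0"
  shows "norm q \<ge> 1"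
proof -
  have "0 \<in> ring_of_integers K" "1 \<in> ring_of_integers K"
    using assms(1) by (auto simp: ring_of_integers_def imaginary_quadratic_field_def)
  then show ?thesis
    \<comment> \<open>\<open>q\<close> is the determinant of the diagonal matrix with entries
      \<open>q\<close> and 1.\<close>
    using ring_of_integers_det[OF assms(1), of q 0 0 1] assms(2,3) by simp
qed

section \<open>Supports of Ahlfors regular measures\<close>

lemma measure_support_alt:
  "measure_support M = - \<Union>{U. open U \<and> emeasure M U = 0}"
  by (auto simp: measure_support_def zero_less_iff_neq_zero)

lemma closed_measure_support: "closed (measure_support M)"
  unfolding measure_support_alt by (intro closed_Compl open_Union) auto

text \<open>The complement is a possibly uncountable union of open null sets; second countability
  reduces it to a countable one.\<close>

lemma null_set_compl_support:
  fixes M :: "'a::second_countable_topology measure"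
  assumes "sets M = sets borel"
  shows "- measure_support M \<in> null_sets M"
proof -
  obtain F where F: "F \<subseteq> {U. open U \<and> emeasure M U = 0}" "countable F"
    "\<Union>F = \<Union>{U. open U \<and> emeasure M U = 0}"
    using Lindelof[of "{U. open U \<and> emeasure M U = 0}"] by blast
  have "\<Union>F \<in> null_sets M"
  proof (rule null_sets_UN'[OF F(2), where N = "\<lambda>U. U", simplified])
    fix U assume "U \<in> F"
    then have "open U" "emeasure M U = 0" using F(1) by blast+
    moreover have "U \<in> sets M" unfolding assms using \<open>open U\<close> by (rule borel_open)
    ultimately show "U \<in> null_sets M" by (intro null_setsI)
  qed
  then show ?thesis
    by (simp only: measure_support_alt F(3) double_complement)
qed

text \<open>If no such point existed, the support inside the ball of radius
  \<open>(1 - \<beta>) * r\<close> about \<open>c\<close> would lie within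
  \<open>4 * \<beta> * r\<close> of \<open>c\<close>, and the two Ahlfors bounds would clash for
  small \<open>\<beta>\<close>. The two distances are Bob's nesting and avoidance rules for the next
  radius \<open>\<beta> * r\<close>.\<close>

lemma Ahlfors_regular_diffuse:
  fixes M :: "'a::{metric_space, second_countable_topology} measure"
  assumes sets: "sets M = sets borel" and reg: "Ahlfors_regular M"
  obtains \<beta>0 R :: real where "0 < \<beta>0" "\<beta>0 < 1" "0 < R"
    "\<And>\<beta> c r y. 0 < \<beta> \<Longrightarrow> \<beta> < \<beta>0 \<Longrightarrow> c \<in> measure_support M \<Longrightarrow> 0 < r \<Longrightarrow> r \<le> R \<Longrightarrow>
       \<exists>c'\<in>measure_support M. dist c' c \<le> (1 - \<beta>) * r \<and> dist c' y > 2 * \<beta> * r"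
proof -
  let ?Y = "measure_support M"
  obtain a b d R :: real where pos: "a > 0" "b > 0" "d > 0" "R > 0"
    and meas: "\<And>z r. z \<in> ?Y \<Longrightarrow> 0 < r \<Longrightarrow> r \<le> R \<Longrightarrow>
          ennreal (a * r powr d) \<le> emeasure M (cball z r) \<and>
          emeasure M (cball z r) \<le> ennreal (b * r powr d)"
    using reg unfolding Ahlfors_regular_def by (elim exE conjE) metis
  \<comment> \<open>Below 1/8, \<open>(1 - \<beta>) * r\<close> is at least \<open>r / 2\<close>, so
    the ratio of the two radii is at most \<open>8 * \<beta>\<close>. The second bound makes
    \<open>b * (8 * \<beta>) powr d\<close> less than \<open>a\<close>.\<close>
  define \<beta>0 where "\<beta>0 = min (1/8) ((a / b) powr (1 / d) / 8)"
  show thesis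
  proof (rule that)
    show "0 < \<beta>0" "\<beta>0 < 1" "0 < R" using pos by (auto simp: \<beta>0_def)
  next
    fix \<beta> r :: real and c y :: 'a
    assume \<beta>: "0 < \<beta>" "\<beta> < \<beta>0" and c: "c \<in> ?Y" and r: "0 < r" "r \<le> R"
    have b8: "\<beta> < 1/8" and bab: "8 * \<beta> < (a / b) powr (1 / d)"
      using \<beta>(2) by (auto simp: \<beta>0_def)
    show "\<exists>c'\<in>?Y. dist c' c \<le> (1 - \<beta>) * r \<and> dist c' y > 2 * \<beta> * r"
    proof (cases "dist c y > 2 * \<beta> * r")
      case True
      have "0 \<le> (1 - \<beta>) * r" using b8 r by simp
      then show ?thesis using True c by (intro bexI[of _ c]) simp_all
    next
      case near: False
      \<comment> \<open>Since \<open>y\<close> is within \<open>2 * \<beta> * r\<close> of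
        \<open>c\<close>, leaving the ball of radius \<open>4 * \<beta> * r\<close> about
        \<open>c\<close> is enough. Recentring matters because \<open>y\<close> may lie off the
        support, where no measure bound is given.\<close>
      have "\<exists>c'\<in>?Y. dist c' c \<le> (1 - \<beta>) * r \<and> dist c' c > 4 * \<beta> * r"
      proof (rule ccontr)
        let ?A = "cball c ((1 - \<beta>) * r)" and ?B = "cball c (4 * \<beta> * r)"
        assume "\<not> ?thesis"
        then have "dist c z \<le> 4 * \<beta> * r" if "z \<in> ?Y" "dist c z \<le> (1 - \<beta>) * r" for z
          using that by (metis dist_commute not_less)
        then have sub: "?A \<subseteq> ?B \<union> - ?Y" by auto
        have "(1 - \<beta>) * r \<le> 1 * r" using \<beta> r by (intro mult_right_mono) auto
        then have rA: "0 < (1 - \<beta>) * r" "(1 - \<beta>) * r \<le> R"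
          using b8 r by (auto intro: mult_pos_pos simp only: mult_1)
        have "4 * \<beta> * r \<le> 1 * r" using b8 r by (intro mult_right_mono) auto
        then have "4 * \<beta> * r \<le> R" using r by linarith
        moreover have "0 < 4 * \<beta> * r" using \<beta>(1) r by simp
        ultimately have rB: "0 < 4 * \<beta> * r" "4 * \<beta> * r \<le> R" by blast+
        have [measurable]: "?B \<in> sets M" using sets by auto
        have null: "- ?Y \<in> null_sets M" using sets by (rule null_set_compl_support)
        have "ennreal (a * ((1 - \<beta>) * r) powr d) \<le> emeasure M ?A"
          using meas[OF c rA] by blast
        also have "\<dots> \<le> emeasure M (?B \<union> - ?Y)"
          using sub null by (intro emeasure_mono) (auto intro: null_setsD2)
        also have "\<dots> = emeasure M ?B"
          using null by (intro emeasure_Un_null_set) auto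
        also have "\<dots> \<le> ennreal (b * (4 * \<beta> * r) powr d)"
          using meas[OF c rB] by blast
        finally have le: "a * ((1 - \<beta>) * r) powr d \<le> b * (4 * \<beta> * r) powr d"
          using pos by (simp add: ennreal_le_iff)
        have "r / 2 \<le> (1 - \<beta>) * r"
          using mult_right_mono[of "1/2" "1 - \<beta>" r] b8 r by simp
        then have "a * (r / 2) powr d \<le> a * ((1 - \<beta>) * r) powr d"
          using pos r by (intro mult_left_mono powr_mono2) auto
        also note le
        also have "b * (4 * \<beta> * r) powr d = b * ((8 * \<beta>) powr d * (r / 2) powr d)"
          using \<beta> r by (subst powr_mult[symmetric]) (auto simp: mult_ac)
        finally have "a \<le> b * (8 * \<beta>) powr d"
          using r by (simp flip: mult.assoc)
        also have "\<dots> < b * ((a / b) powr (1 / d)) powr d"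
          using bab \<beta> pos by (intro mult_strict_left_mono powr_less_mono2) auto
        also have "\<dots> = a" using pos by (simp add: powr_powr)
        finally show False by simp
      qed
      then obtain c' where c': "c' \<in> ?Y" "dist c' c \<le> (1 - \<beta>) * r" "dist c' c > 4 * \<beta> * r"
        by blast
      have "dist c' y > 2 * \<beta> * r"
        using c'(3) near dist_triangle[of c' c y] by (simp add: dist_commute)
      then show ?thesis using c' by blast
    qed
  qed
qed

section \<open>Positional strategies in the absolute game\<close>

text \<open>Alice is memoryless and always deletes the largest permitted radius. Without history,
  the same \<open>f\<close> also governs a play restarted from any legal ball.\<close>

definition positional_play ::
  "'a::metric_space set \<Rightarrow> real \<Rightarrow> ('a formal_ball \<Rightarrow> 'a) \<Rightarrow> (nat \<Rightarrow> 'a formal_ball) \<Rightarrow> bool" where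
  "positional_play Y \<beta> f B \<longleftrightarrow>
     (\<forall>n. legal_first Y (B n) \<and> legal_Bob Y \<beta> (B n) ({f (B n)}, \<beta> * snd (B n)) (B (Suc n)))"

lemma positional_play_nested:
  assumes "positional_play Y \<beta> f B" "m \<le> n"
  shows "dist (fst (B m)) (fst (B n)) \<le> snd (B m) - snd (B n)"
  using assms(2)
proof (induction n rule: dec_induct)
  case (step n)
  have "dist (fst (B (Suc n))) (fst (B n)) \<le> snd (B n) - snd (B (Suc n))"
    using assms(1) unfolding positional_play_def legal_Bob_def formal_le_def by blast
  then show ?case
    using step dist_triangle[of "fst (B m)" "fst (B (Suc n))" "fst (B n)"]
    by (simp add: dist_commute)
qed auto

text \<open>Nesting bounds distances of centres by differences of convergent radii, so the centres
  are Cauchy. The term \<open>- L\<close> records that the whole ball of radius \<open>L\<close>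
  about \<open>x\<close> lies in every ball of the play.\<close>

lemma positional_play_limit:
  fixes Y :: "'a::complete_space set"
  assumes Y: "closed Y" and B: "positional_play Y \<beta> f B"
  obtains x L where "x \<in> Y" "0 \<le> L" "(\<lambda>n. snd (B n)) \<longlonglongrightarrow> L"
    "\<And>n. dist (fst (B n)) x \<le> snd (B n) - L"
proof -
  have pos: "snd (B n) > 0" and cY: "fst (B n) \<in> Y" for n
    using B unfolding positional_play_def legal_first_def by auto
  have "decseq (\<lambda>n. snd (B n))"
    unfolding decseq_def
  proof (intro allI impI)
    fix m n :: nat assume "m \<le> n"
    from positional_play_nested[OF B this] show "snd (B n) \<le> snd (B m)"
      using zero_le_dist[of "fst (B m)" "fst (B n)"] by linarith
  qed
  then obtain L where L: "(\<lambda>n. snd (B n)) \<longlonglongrightarrow> L"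
    using decseq_convergent[of "\<lambda>n. snd (B n)" 0] pos less_imp_le by metis
  have L0: "0 \<le> L" using L pos by (intro LIMSEQ_le_const) (auto intro: less_imp_le)
  have "Cauchy (\<lambda>n. fst (B n))"
  proof (rule metric_CauchyI)
    fix e :: real assume "e > 0"
    then obtain N where N: "\<And>m n. m \<ge> N \<Longrightarrow> n \<ge> N \<Longrightarrow> dist (snd (B m)) (snd (B n)) < e"
      using metric_CauchyD[OF LIMSEQ_imp_Cauchy[OF L]] by blast
    have "dist (fst (B m)) (fst (B n)) < e" if "m \<ge> N" "n \<ge> N" for m n
    proof (cases "m \<le> n")
      case True
      then show ?thesis using positional_play_nested[OF B, of m n] N[OF that]
        by (simp add: dist_real_def)
    next
      case False
      then show ?thesis using positional_play_nested[OF B, of n m] N[OF that]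
        by (simp add: dist_real_def dist_commute)
    qed
    then show "\<exists>N. \<forall>m\<ge>N. \<forall>n\<ge>N. dist (fst (B m)) (fst (B n)) < e" by blast
  qed
  then obtain x where x: "(\<lambda>n. fst (B n)) \<longlonglongrightarrow> x"
    using Cauchy_convergent_iff convergent_def by blast
  have "x \<in> Y" using closed_sequentially[OF Y _ x] cY by simp
  moreover have "dist (fst (B n)) x \<le> snd (B n) - L" for n
  proof (rule LIMSEQ_le)
    show "(\<lambda>k. dist (fst (B n)) (fst (B k))) \<longlonglongrightarrow> dist (fst (B n)) x"
      "(\<lambda>k. snd (B n) - snd (B k)) \<longlonglongrightarrow> snd (B n) - L"
      by (intro tendsto_intros x L)+
    show "\<exists>N. \<forall>k\<ge>N. dist (fst (B n)) (fst (B k)) \<le> snd (B n) - snd (B k)"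
      using positional_play_nested[OF B] by blast
  qed
  ultimately show thesis using that L L0 by blast
qed

text \<open>
  Bob need not let his radii tend to 0. In that case his balls contain a common ball centred on
  \<^term>\<open>Y\<close>, in which the game can be replayed with radii shrinking by the factor \<^term>\<open>\<beta>\<close>.
\<close>

lemma game_winning_positional:
  fixes Y :: "'a::complete_space set"
  assumes Y: "closed Y" and \<beta>: "0 < \<beta>" "\<beta> < 1"
    and escape: "\<And>c r. c \<in> Y \<Longrightarrow> 0 < r \<Longrightarrow>
        \<exists>c'\<in>Y. dist c' c \<le> (1 - \<beta>) * r \<and> dist c' (f (c, r)) > 2 * \<beta> * r"
    and win: "\<And>B x. positional_play Y \<beta> f B \<Longrightarrow> (\<lambda>n. snd (B n)) \<longlonglongrightarrow> 0 \<Longrightarrow>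
        (\<And>n. x \<in> ball_of (B n)) \<Longrightarrow> x \<in> W"
  shows "game_winning (range (\<lambda>x. {x})) \<beta> W Y"
proof -
  define \<sigma> :: "'a strategy" where "\<sigma> bs = ({f (last bs)}, \<beta> * snd (last bs))" for bs
  have reply: "reply \<sigma> B n = ({f (B n)}, \<beta> * snd (B n))" for B n
    by (simp add: reply_def \<sigma>_def)
  have first: "legal_first Y (B n)" if "legal_upto Y \<beta> \<sigma> B n" for B n
    using that by (cases n) (auto simp: legal_upto_def legal_first_def legal_Bob_def)
  \<comment> \<open>Bob takes the smallest permitted radius; his two distance conditions then become
    those of \<open>escape\<close>.\<close>
  have move: "\<exists>c'. legal_Bob Y \<beta> b ({f b}, \<beta> * snd b) (c', \<beta> * snd b)" if b: "legal_first Y b" for b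
  proof -
    obtain c' where c': "c' \<in> Y" "dist c' (fst b) \<le> (1 - \<beta>) * snd b"
      "dist c' (f (fst b, snd b)) > 2 * \<beta> * snd b"
      using escape b unfolding legal_first_def by blast
    have "\<beta> * snd b \<le> 1 * snd b"
      using b \<beta> by (intro mult_right_mono) (auto simp: legal_first_def)
    then have "legal_Bob Y \<beta> b ({f b}, \<beta> * snd b) (c', \<beta> * snd b)"
      using b c' \<beta> by (auto simp: legal_Bob_def legal_first_def formal_le_def dist_set_greater_def
          algebra_simps)
    then show ?thesis by blast
  qed
  have inter: "W \<inter> Y \<inter> (\<Inter>n. ball_of (B n)) \<noteq> {}" if up: "\<And>n. legal_upto Y \<beta> \<sigma> B n" for B
  proof -
    have B: "positional_play Y \<beta> f B"
      unfolding positional_play_def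
    proof (intro allI conjI)
      fix n
      show "legal_first Y (B n)" using first up by blast
      have "legal_Bob Y \<beta> (B n) (reply \<sigma> B n) (B (Suc n))"
        using up[of "Suc n"] unfolding legal_upto_def by blast
      then show "legal_Bob Y \<beta> (B n) ({f (B n)}, \<beta> * snd (B n)) (B (Suc n))"
        unfolding reply .
    qed
    obtain x L where x: "x \<in> Y" "0 \<le> L" "(\<lambda>n. snd (B n)) \<longlonglongrightarrow> L"
      "\<And>n. dist (fst (B n)) x \<le> snd (B n) - L"
      using positional_play_limit[OF Y B] by blast
    show ?thesis
    proof (cases "L = 0")
      case True
      then have "x \<in> ball_of (B n)" for n using x(4)[of n] by (simp add: ball_of_def)
      then show ?thesis using win[OF B] x True by blast
    next
      case False
      then have L: "L > 0" using x by simp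
      obtain g where g: "\<And>b. legal_first Y b \<Longrightarrow>
          legal_Bob Y \<beta> b ({f b}, \<beta> * snd b) (g b, \<beta> * snd b)"
        using move by metis
      \<comment> \<open>The replay starts from \<open>(x, L)\<close>, legal since \<open>x\<close>
        is in \<open>Y\<close> and \<open>L > 0\<close>. Its radii tend to 0, so \<open>win\<close>
        applies to it.\<close>
      define C where "C n = ((\<lambda>b. (g b, \<beta> * snd b)) ^^ n) (x, L)" for n
      have CSuc: "C (Suc n) = (g (C n), \<beta> * snd (C n))" and C0: "C 0 = (x, L)" for n
        by (simp_all add: C_def)
      have Cf: "legal_first Y (C n)" for n
      proof (induction n)
        case (Suc n)
        then show ?case using g[OF Suc] by (simp add: CSuc legal_Bob_def legal_first_def)
      qed (simp add: C0 x L legal_first_def)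
      have C: "positional_play Y \<beta> f C"
        unfolding positional_play_def using Cf g CSuc by simp
      have "snd (C n) = \<beta> ^ n * L" for n by (induction n) (auto simp: C0 CSuc)
      moreover have "(\<lambda>n. \<beta> ^ n * L) \<longlonglongrightarrow> 0 * L"
        using \<beta> by (intro tendsto_mult LIMSEQ_power_zero tendsto_const) auto
      ultimately have lim: "(\<lambda>n. snd (C n)) \<longlonglongrightarrow> 0" by simp
      obtain y L' where y: "y \<in> Y" "0 \<le> L'" "\<And>n. dist (fst (C n)) y \<le> snd (C n) - L'"
        using positional_play_limit[OF Y C] by blast
      have yC: "dist (fst (C n)) y \<le> snd (C n)" for n using y(2) y(3)[of n] by linarith
      then have "y \<in> W" using win[OF C lim] by (simp add: ball_of_def)
      \<comment> \<open>\<open>y\<close> is within \<open>L\<close> of \<open>x\<close> because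
        \<open>C 0 = (x, L)\<close>, and \<open>x\<close> is within \<open>snd (B n) - L\<close> of
        the centre of \<open>B n\<close>.\<close>
      moreover have "y \<in> ball_of (B n)" for n
        using yC[of 0] x(4)[of n] dist_triangle[of "fst (B n)" y x]
        by (simp add: ball_of_def C0)
      ultimately show ?thesis using y(1) by blast
    qed
  qed
  have "legal_Alice (range (\<lambda>x. {x})) \<beta> (B n) (reply \<sigma> B n)"
    and "\<exists>B'. legal_Bob Y \<beta> (B n) (reply \<sigma> B n) B'" if "legal_upto Y \<beta> \<sigma> B n" for B n
    using first[OF that] move[OF first[OF that]] \<beta>
    by (auto simp: reply legal_Alice_def legal_first_def)
  then show ?thesis
    unfolding game_winning_def using inter by (intro exI[of _ \<sigma>]) blast
qed

section \<open>Alice's strategy\<close>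

text \<open>The point \<open>- p / q\<close> is the zero of q x + p. The window is twice as wide as
  the ball, so fractions outside it keep a distance above \<open>snd b\<close> from the ball even if
  they are not deleted.\<close>

definition near_fractions :: "complex set \<Rightarrow> complex formal_ball \<Rightarrow> complex set" where
  "near_fractions K b = {- p / q | p q. p \<in> ring_of_integers K \<and> q \<in> ring_of_integers K - {0} \<and>
     4 * snd b * (norm q)\<^sup>2 < 1 \<and> dist (fst b) (- p / q) \<le> 2 * snd b}"

text \<open>Up to sign, the difference of the fractions is the determinant over
  \<open>q * q'\<close>, and they are at most \<open>4 * snd b\<close> apart. By AM-GM,
  \<open>4 * snd b * norm (q * q')\<close> is at most the mean of two numbers below 1, so a nonzero
  determinant would have norm below 1.\<close>

lemma near_fractions_unique:
  assumes K: "imaginary_quadratic_field K" and "snd b > 0"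
    and "z \<in> near_fractions K b" "z' \<in> near_fractions K b"
  shows "z = z'"
proof (rule ccontr)
  assume "z \<noteq> z'"
  let ?O = "ring_of_integers K"
  obtain p q where z: "z = - p / q" and pq: "p \<in> ?O" "q \<in> ?O" "q \<noteq> 0"
    and q: "4 * snd b * (norm q)\<^sup>2 < 1" and d: "dist (fst b) z \<le> 2 * snd b"
    using assms(3) unfolding near_fractions_def by blast
  obtain p' q' where z': "z' = - p' / q'" and pq': "p' \<in> ?O" "q' \<in> ?O" "q' \<noteq> 0"
    and q': "4 * snd b * (norm q')\<^sup>2 < 1" and d': "dist (fst b) z' \<le> 2 * snd b"
    using assms(4) unfolding near_fractions_def by blast
  have det: "p * q' - p' * q = - (q * q' * (z - z'))"
    using pq(3) pq'(3) by (simp add: z z' field_simps)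
  then have "1 \<le> norm (p * q' - p' * q)"
    using \<open>z \<noteq> z'\<close> pq pq' by (intro ring_of_integers_det[OF K]) auto
  also have "\<dots> = norm q * norm q' * dist z z'"
    by (simp add: det norm_mult dist_norm)
  also have "\<dots> \<le> norm q * norm q' * (4 * snd b)"
    using d d' dist_triangle[of z z' "fst b"]
    by (intro mult_left_mono) (auto simp: dist_commute)
  finally have "1 \<le> 4 * snd b * (norm q * norm q')" by (simp add: mult_ac)
  moreover have "4 * snd b * (2 * (norm q * norm q')) \<le> 4 * snd b * ((norm q)\<^sup>2 + (norm q')\<^sup>2)"
    using assms(2) sum_squares_bound[of "norm q" "norm q'"]
    by (intro mult_left_mono) (auto simp: mult_ac)
  ultimately show False using q q' by (simp add: distrib_left)
qed

text \<open>The fallback \<open>c + 4 r\<close> is a point too far from the ball to constrain Bob.\<close>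

definition nearest_fraction :: "complex set \<Rightarrow> real \<Rightarrow> complex formal_ball \<Rightarrow> complex" where
  "nearest_fraction K R b =
     (if snd b < R \<and> near_fractions K b \<noteq> {} then SOME z. z \<in> near_fractions K b
      else fst b + of_real (4 * snd b))"

lemma nearest_fraction_play_BA:
  assumes K: "imaginary_quadratic_field K" and \<beta>: "0 < \<beta>" "\<beta> < 1" and R: "R > 0"
    and B: "positional_play Y \<beta> (nearest_fraction K R) B"
    and lim: "(\<lambda>n. snd (B n)) \<longlonglongrightarrow> 0" and x: "\<And>n. x \<in> ball_of (B n)"
  shows "x \<in> BA K"
proof -
  have pos: "snd (B n) > 0" for n
    using B unfolding positional_play_def legal_first_def by blast
  have shrink: "\<beta> * snd (B n) \<le> snd (B (Suc n))"
    and avoid: "dist (fst (B (Suc n))) (nearest_fraction K R (B n)) > \<beta> * snd (B n) + snd (B (Suc n))"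
    for n
    using B unfolding positional_play_def legal_Bob_def dist_set_greater_def by auto
  have xB: "dist (fst (B n)) x \<le> snd (B n)" for n
    using x by (simp add: ball_of_def)
  \<comment> \<open>A lower bound, independent of \<open>q\<close>, for |q|^2 times the radius of
    the first ball satisfying \<open>Q\<close>. The first entry covers the case that this is
    \<open>B 0\<close>; the second covers a ball whose predecessor failed \<open>Q\<close>, from
    which the radius drops at most by the factor \<open>\<beta>\<close>.\<close>
  define \<kappa> where "\<kappa> = min (snd (B 0)) (\<beta> * min R (1/4))"
  have \<kappa>: "\<kappa> > 0" using pos R \<beta> by (simp add: \<kappa>_def)
  have "norm (q * x + p) > \<beta> * \<kappa> * inverse (norm q)"
    if p: "p \<in> ring_of_integers K" and q: "q \<in> ring_of_integers K - {0}" for p q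
  proof -
    have q0: "q \<noteq> 0" and q1: "norm q \<ge> 1" using ring_of_integers_norm_ge_1[OF K] q by auto
    then have qq: "(norm q)\<^sup>2 \<ge> 1" by simp
    define z where "z = - p / q"
    define Q where "Q n \<longleftrightarrow> snd (B n) < R \<and> 4 * snd (B n) * (norm q)\<^sup>2 < 1" for n
    \<comment> \<open>Both conditions in \<open>Q\<close> bound the radius from above and merge into
      the threshold \<open>e\<close>. Because \<open>norm q\<close> is at least 1, \<open>R\<close>
      may be replaced by \<open>R / (norm q)^2\<close>, which gives a lower bound for
      \<open>e\<close> of the right order.\<close>
    define e where "e = min R (1 / (4 * (norm q)\<^sup>2))"
    have Qe: "Q n \<longleftrightarrow> snd (B n) < e" for n
      using q0 by (auto simp: Q_def e_def field_simps)
    have e: "e > 0" "min R (1/4) / (norm q)\<^sup>2 \<le> e"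
    proof -
      show "e > 0" using R q0 by (simp add: e_def)
      have "min R (1/4) / (norm q)\<^sup>2 \<le> R / (norm q)\<^sup>2" by (intro divide_right_mono) auto
      also have "\<dots> \<le> R" using R qq by (simp add: divide_le_eq mult_le_cancel_left1)
      finally have "min R (1/4) / (norm q)\<^sup>2 \<le> R" .
      moreover have "min R (1/4) / (norm q)\<^sup>2 \<le> (1/4) / (norm q)\<^sup>2" by (intro divide_right_mono) auto
      ultimately show "min R (1/4) / (norm q)\<^sup>2 \<le> e" by (simp add: e_def)
    qed
    have "\<exists>n. Q n"
      unfolding Qe using order_tendstoD(2)[OF lim e(1)] by (auto simp: eventually_sequentially)
    define n where "n = (LEAST n. Q n)"
    have Qn: "Q n" unfolding n_def using \<open>\<exists>n. Q n\<close> by (rule LeastI_ex)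
    have low: "\<kappa> / (norm q)\<^sup>2 \<le> snd (B n)"
    proof (cases n)
      case 0
      have "\<kappa> / (norm q)\<^sup>2 \<le> \<kappa>" using \<kappa> qq by (simp add: divide_le_eq mult_le_cancel_left1)
      then show ?thesis using 0 by (simp add: \<kappa>_def)
    next
      case (Suc m)
      then have "\<not> Q m" unfolding n_def by (metis lessI not_less_Least)
      then have "e \<le> snd (B m)" by (simp add: Qe)
      then have "\<beta> * (min R (1/4) / (norm q)\<^sup>2) \<le> \<beta> * snd (B m)"
        using e(2) \<beta> by (intro mult_left_mono) auto
      moreover have "\<kappa> / (norm q)\<^sup>2 \<le> (\<beta> * min R (1/4)) / (norm q)\<^sup>2"
        by (intro divide_right_mono) (auto simp: \<kappa>_def)
      ultimately show ?thesis using shrink[of m] Suc by simp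
    qed
    \<comment> \<open>If \<open>z\<close> is in the window, it is deleted and the next ball, which
      contains \<open>x\<close>, stays \<open>\<beta> * snd (B n)\<close> away. Otherwise
      \<open>z\<close> is more than two radii from the centre, while \<open>x\<close> is within
      one.\<close>
    have "dist x z > \<beta> * snd (B n)"
    proof (cases "dist (fst (B n)) z \<le> 2 * snd (B n)")
      case True
      then have z: "z \<in> near_fractions K (B n)"
        using p q Qn unfolding near_fractions_def Q_def z_def by blast
      then have "(SOME z. z \<in> near_fractions K (B n)) = z"
        using near_fractions_unique[OF K pos] by (metis someI)
      then have "nearest_fraction K R (B n) = z"
        using z Qn by (auto simp: nearest_fraction_def Q_def)
      then show ?thesis
        using avoid[of n] xB[of "Suc n"] dist_triangle[of "fst (B (Suc n))" z x] by simp
    next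
      case False
      have "\<beta> * snd (B n) < 1 * snd (B n)" using \<beta> pos by (intro mult_strict_right_mono) auto
      then show ?thesis
        using False xB[of n] dist_triangle[of "fst (B n)" z x] by simp
    qed
    moreover have "\<beta> * (\<kappa> / (norm q)\<^sup>2) \<le> \<beta> * snd (B n)"
      using low \<beta> by (intro mult_left_mono) auto
    ultimately have "\<beta> * (\<kappa> / (norm q)\<^sup>2) < dist x z" by simp
    then have "norm q * (\<beta> * (\<kappa> / (norm q)\<^sup>2)) < norm q * dist x z"
      using q0 by (intro mult_strict_left_mono) auto
    moreover have "norm q * dist x z = norm (q * x + p)"
    proof -
      have "q * x + p = q * (x - z)" using q0 by (simp add: z_def field_simps)
      then show ?thesis by (simp add: norm_mult dist_norm)
    qed
    moreover have "norm q * (\<beta> * (\<kappa> / (norm q)\<^sup>2)) = \<beta> * \<kappa> * inverse (norm q)"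
      using q0 by (simp add: field_simps power2_eq_square)
    ultimately show ?thesis by simp
  qed
  then show ?thesis
    unfolding BA_def using \<kappa> \<beta> by (intro CollectI exI[of _ "\<beta> * \<kappa>"]) auto
qed

theorem corollary1p6:
  fixes K :: "complex set" and \<mu> :: "complex measure" and Y :: "complex set"
  assumes "imaginary_quadratic_field K"
    and "sets \<mu> = sets borel"
    and "Ahlfors_regular \<mu>"
    and "Y = measure_support \<mu>"
  shows "absolute_winning (BA K) Y"
proof -
  obtain \<beta>0 R :: real where \<beta>0: "0 < \<beta>0" "\<beta>0 < 1" and R: "0 < R"
    and diffuse: "\<And>\<beta> c r y. 0 < \<beta> \<Longrightarrow> \<beta> < \<beta>0 \<Longrightarrow> c \<in> Y \<Longrightarrow> 0 < r \<Longrightarrow> r \<le> R \<Longrightarrow>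
       \<exists>c'\<in>Y. dist c' c \<le> (1 - \<beta>) * r \<and> dist c' y > 2 * \<beta> * r"
    using Ahlfors_regular_diffuse[OF assms(2,3)] unfolding assms(4) by metis
  have "game_winning (range (\<lambda>x. {x})) \<beta> (BA K) Y" if \<beta>: "0 < \<beta>" "\<beta> < \<beta>0" for \<beta>
  proof (rule game_winning_positional)
    show "closed Y" unfolding assms(4) by (rule closed_measure_support)
    show "0 < \<beta>" "\<beta> < 1" using \<beta> \<beta>0 by auto
    show "x \<in> BA K" if "positional_play Y \<beta> (nearest_fraction K R) B"
      "(\<lambda>n. snd (B n)) \<longlonglongrightarrow> 0" "\<And>n. x \<in> ball_of (B n)" for B x
      using nearest_fraction_play_BA[OF assms(1) _ _ R that] \<beta> \<beta>0 by simp
  next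
    fix c r assume c: "c \<in> Y" and r: "(0::real) < r"
    show "\<exists>c'\<in>Y. dist c' c \<le> (1 - \<beta>) * r \<and> dist c' (nearest_fraction K R (c, r)) > 2 * \<beta> * r"
    proof (cases "r < R")
      case True
      \<comment> \<open>\<open>diffuse\<close> tolerates any deleted point, a fraction as well as
        the fallback.\<close>
      then show ?thesis using diffuse \<beta> c r by simp
    next
      case False
      \<comment> \<open>On a large ball the deleted point is at distance \<open>4 * r\<close>, so
        Bob can keep his centre.\<close>
      then have "dist c (nearest_fraction K R (c, r)) = 4 * r"
        using r by (simp add: nearest_fraction_def dist_norm)
      moreover have "2 * \<beta> * r < 4 * r" "0 \<le> (1 - \<beta>) * r"
        using \<beta> \<beta>0 r by auto
      ultimately show ?thesis using c by (intro bexI[of _ c]) auto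
    qed
  qed
  then show ?thesis
    unfolding absolute_winning_def H_absolute_winning_def using \<beta>0 by (intro exI[of _ \<beta>0]) auto
qed

end
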